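(* Let $\alpha>0$ be a constant and let $\mathcal{L}$ be a half-line (the origin $o$ is an endpoint of $\mathcal{L}$). Consider the following deterministic online algorithm: starting at time $0$, the server traverses $\mathcal{L}$ in round trips $RT_1,RT_2,\dots$, each starting at and ending at $o$, as long as there is at least one outstanding request; in $RT_1$ it travels from $o$ to distance $\frac{2+2\alpha}{2}=1+\alpha$ from $o$ and back, and in $RT_j$ for $j\ge 2$ it travels from $o$ to distance $\frac{(2+2\alpha)^{j-1}(1+2\alpha)}{2}$ from $o$ and back. This algorithm is $\max\{2+2\alpha,\ \frac{5+6\alpha}{1+2\alpha}\}$-competitive for online TRP on the half-line $\mathcal{L}$ in the original model.
   Context: Online traveling repairperson problem (TRP): $\mathcal{L}$ is a segment of the real line containing a distinguished point $o$ (the origin); a half-line is the case where $o$ is an endpoint of $\mathcal{L}$. A single server starts at $o$ at time $0$ and moves at unit speed. Time proceeds in discrete steps. Requests arrive over time; request $r_i$ arrives at time $t_i\ge 0$ at a point of $\mathcal{L}$ and (original model) becomes known only at time $t_i$. Request $r_i$ is completed at the first time $t_i'\ge t_i$ at which the server is at its location. The cost of an online algorithm $ON$ is $ON(\mathcal{R})=\sum_i t_i'$; $OPT(\mathcal{R})$ is the optimal offline sum of completion times (per request, the optimal completion time of $r_i$ is at least $\max\{t_i,l_i\}$ where $l_i$ is the distance of its location from $o$). An algorithm is $c$-competitive if $ON(\mathcal{R})\le c\cdot OPT(\mathcal{R})$ for every input $\mathcal{R}$. *)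

theory Defs
  imports "HOL-Analysis.Analysis" "HOL-Library.Multiset" "HOL-Library.Extended_Real"
begin

(* Time is discrete as far as arrivals are concerned; the server itself moves
   continuously, and locations are arbitrary points of the line. *)
datatype request = Request (arrival: nat) (location: real)

(* Both orientations are allowed, and the origin need not be the point 0. *)
definition half_line :: "real \<Rightarrow> real set \<Rightarrow> bool" where
  "half_line orig L \<longleftrightarrow> L = {orig..} \<or> L = {..orig}"

definition inputs :: "real set \<Rightarrow> request multiset set" where
  "inputs L = {R. \<forall>r \<in># R. location r \<in> L}"

(* A schedule gives the position of the server at each time s >= 0; its values at negative
   times are irrelevant. The Lipschitz constant 1 is the unit speed bound, so the
   server may also wait. *)
definition schedules :: "real \<Rightarrow> real set \<Rightarrow> (real \<Rightarrow> real) set" where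
  "schedules orig L = {p. p 0 = orig \<and> p ` {0..} \<subseteq> L \<and> 1-lipschitz_on {0..} p}"

definition visits :: "(real \<Rightarrow> real) \<Rightarrow> request \<Rightarrow> real set" where
  "visits p r = {s. real (arrival r) \<le> s \<and> p s = location r}"

definition completed_by :: "(real \<Rightarrow> real) \<Rightarrow> request \<Rightarrow> real \<Rightarrow> bool" where
  "completed_by p r T \<longleftrightarrow> (\<exists>s \<in> visits p r. s \<le> T)"

(* For a schedule the infimum is attained whenever there is a visit, so it is the first
   visit; a request that is never visited has completion time infinity. *)
definition completion_time :: "(real \<Rightarrow> real) \<Rightarrow> request \<Rightarrow> ereal" where
  "completion_time p r = (INF s \<in> visits p r. ereal s)"

definition cost :: "(real \<Rightarrow> real) \<Rightarrow> request multiset \<Rightarrow> ereal" where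
  "cost p R = (\<Sum>r \<in># R. completion_time p r)"

definition OPT :: "real \<Rightarrow> real set \<Rightarrow> request multiset \<Rightarrow> ereal" where
  "OPT orig L R = (INF p \<in> schedules orig L. cost p R)"

(* A deterministic algorithm maps each input to a schedule. It is online if its position at
   time s is determined by the requests that have arrived by then. The comparison
   is made only while both inputs still have requests to be completed: learning that the
   whole input has been completed cannot influence any cost. *)
definition online_algorithm ::
  "real \<Rightarrow> real set \<Rightarrow> (request multiset \<Rightarrow> real \<Rightarrow> real) \<Rightarrow> bool" where
  "online_algorithm orig L A \<longleftrightarrow>
     (\<forall>R \<in> inputs L. A R \<in> schedules orig L) \<and>
     (\<forall>R \<in> inputs L. \<forall>R' \<in> inputs L. \<forall>s \<ge> 0.
        filter_mset (\<lambda>r. real (arrival r) \<le> s) R = filter_mset (\<lambda>r. real (arrival r) \<le> s) R' \<longrightarrow>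
        (\<exists>r \<in># R. \<not> completed_by (A R) r s) \<longrightarrow>
        (\<exists>r \<in># R'. \<not> completed_by (A R') r s) \<longrightarrow>
        A R s = A R' s)"

definition competitive ::
  "real \<Rightarrow> real set \<Rightarrow> real \<Rightarrow> (request multiset \<Rightarrow> real \<Rightarrow> real) \<Rightarrow> bool" where
  "competitive orig L c A \<longleftrightarrow> (\<forall>R \<in> inputs L. cost (A R) R \<le> ereal c * OPT orig L R)"

(* Trips are numbered from 1. *)
definition reach :: "real \<Rightarrow> nat \<Rightarrow> real" where
  "reach \<alpha> j = (if j = 1 then (2 + 2 * \<alpha>) / 2
                else (2 + 2 * \<alpha>) ^ (j - 1) * (1 + 2 * \<alpha>) / 2)"

definition trip_end :: "real \<Rightarrow> nat \<Rightarrow> real" where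
  "trip_end \<alpha> k = (\<Sum>j = 1..k. 2 * reach \<alpha> j)"

(* Distance from the origin at time s >= 0 when the trips follow each other without
   pause: j is the number of the current trip, d the time elapsed since it began. *)
definition trip_dist :: "real \<Rightarrow> real \<Rightarrow> real" where
  "trip_dist \<alpha> s =
     (let j = (LEAST j. 1 \<le> j \<and> s \<le> trip_end \<alpha> j); d = s - trip_end \<alpha> (j - 1)
      in min d (2 * reach \<alpha> j - d))"

definition trips :: "real \<Rightarrow> real \<Rightarrow> real set \<Rightarrow> real \<Rightarrow> real" where
  "trips \<alpha> orig L s = (THE x. x \<in> L \<and> dist orig x = trip_dist \<alpha> s)"

(* Before each trip the server checks whether some request of the input remains to be
   completed (requests that have not arrived yet count), and stays at the origin for good
   if there is none. Up to that moment it has followed trips, so the test may refer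
   to trips. *)
definition round_trip_algorithm ::
  "real \<Rightarrow> real \<Rightarrow> real set \<Rightarrow> request multiset \<Rightarrow> real \<Rightarrow> real" where
  "round_trip_algorithm \<alpha> orig L R s =
     (if \<exists>k. trip_end \<alpha> k \<le> s \<and> (\<forall>r \<in># R. completed_by (trips \<alpha> orig L) r (trip_end \<alpha> k))
      then orig else trips \<alpha> orig L s)"

end

theory Submission
  imports Defs
begin

text \<open>Put \<open>q = 2 + 2 * \<alpha>\<close>. Trip \<open>k\<close> ends at time \<open>q ^ k\<close>, so the distance of the
  server from the origin is its distance in time to the nearest end of a trip, which is
  \<open>1\<close>-Lipschitz. Every schedule completes a request arriving at time \<open>t\<close> at distance
  \<open>l\<close> no earlier than \<open>max t l\<close>, and the round trips complete it within the claimed multiple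
  of \<open>max t l\<close>. Indeed, let \<open>k\<close> be the trip during which it arrives. If the server passes
  the location on the way back of trip \<open>k\<close>, it does so before \<open>q ^ k \<le> q * t\<close>. If it has
  already passed on the way back, then \<open>q ^ k < l + t\<close> and trip \<open>k + 1\<close> serves the request at
  time \<open>q ^ k + l < 3 * max t l\<close>. If trip \<open>k\<close> is too short, the first sufficiently long trip
  \<open>m + 1\<close> serves it at time \<open>q ^ m + l\<close>, where \<open>l\<close> exceeds the reach of trip \<open>m\<close>.\<close>

section \<open>Ends and reaches of the trips\<close>

lemma trip_end_0 [simp]: "trip_end \<alpha> 0 = 0"
  by (simp add: trip_end_def)

lemma trip_end_Suc: "trip_end \<alpha> (Suc k) = trip_end \<alpha> k + 2 * reach \<alpha> (Suc k)"
  by (simp add: trip_end_def)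

lemma reach_1: "reach \<alpha> (Suc 0) = 1 + \<alpha>"
  by (simp add: reach_def field_simps)

lemma reach_Suc_Suc:
  "reach \<alpha> (Suc (Suc k)) = (2 + 2 * \<alpha>) ^ Suc k * (1 + 2 * \<alpha>) / 2"
  by (simp add: reach_def)

text \<open>Since \<open>1 + 2 * \<alpha> = q - 1\<close>, trip \<open>k + 2\<close> takes time
  \<open>q ^ (k + 2) - q ^ (k + 1)\<close>, and the sum telescopes. The index starts at
  \<open>Suc k\<close> because \<open>trip_end \<alpha> 0\<close> is \<open>0\<close>, not
  \<open>q ^ 0\<close>.\<close>

lemma trip_end_eq_power: "trip_end \<alpha> (Suc k) = (2 + 2 * \<alpha>) ^ Suc k"
proof (induction k)
  case 0
  show ?case by (simp add: trip_end_Suc reach_1)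
next
  case (Suc k)
  show ?case
    unfolding trip_end_Suc[of \<alpha> "Suc k"] Suc.IH reach_Suc_Suc by (simp add: field_simps)
qed

context
  fixes \<alpha> :: real
  assumes \<alpha>: "\<alpha> > 0"
begin

lemma reach_pos: "reach \<alpha> (Suc k) > 0"
  using \<alpha> by (cases k) (simp_all add: reach_1 reach_Suc_Suc)

lemma reach_Suc_mono: "reach \<alpha> (Suc k) \<le> reach \<alpha> (Suc (Suc k))"
proof (cases k)
  case 0
  have "1 + \<alpha> \<le> (1 + \<alpha>) * (1 + 2 * \<alpha>)" using \<alpha> by (simp add: field_simps)
  then show ?thesis using 0 by (simp add: reach_1 reach_Suc_Suc field_simps)
next
  case (Suc i)
  have "(2 + 2 * \<alpha>) ^ Suc i \<le> (2 + 2 * \<alpha>) ^ Suc (Suc i)"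
    using \<alpha> by (intro power_increasing) auto
  then show ?thesis
    unfolding Suc reach_Suc_Suc using \<alpha> by (intro divide_right_mono mult_right_mono) auto
qed

lemma trip_end_strict_mono: "strict_mono (trip_end \<alpha>)"
  by (rule strict_mono_Suc_iff[THEN iffD2]) (use reach_pos in \<open>simp add: trip_end_Suc\<close>)

lemma trip_end_le_iff: "trip_end \<alpha> i \<le> trip_end \<alpha> j \<longleftrightarrow> i \<le> j"
  using trip_end_strict_mono by (rule strict_mono_less_eq)

lemma trip_end_nonneg: "0 \<le> trip_end \<alpha> k"
  using trip_end_le_iff[of 0 k] by simp

lemma ex_trip_end_ge: "\<exists>k. x \<le> trip_end \<alpha> k"
proof -
  obtain n where "x < (2 + 2 * \<alpha>) ^ n"
    using real_arch_pow[of "2 + 2 * \<alpha>" x] \<alpha> by auto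
  also have "\<dots> \<le> (2 + 2 * \<alpha>) ^ Suc n"
    using \<alpha> by (intro power_increasing) auto
  finally show ?thesis
    unfolding trip_end_eq_power[symmetric] by (blast intro: less_imp_le)
qed

lemma trip_of_time:
  assumes "0 < x"
  obtains k where "trip_end \<alpha> k < x" "x \<le> trip_end \<alpha> (Suc k)"
proof -
  define k where "k = (LEAST k. x \<le> trip_end \<alpha> k)"
  have k: "x \<le> trip_end \<alpha> k"
    unfolding k_def by (rule LeastI_ex) (rule ex_trip_end_ge)
  then obtain i where i: "k = Suc i"
    using assms by (cases k) auto
  have "\<not> x \<le> trip_end \<alpha> i"
    using not_less_Least[of i "\<lambda>k. x \<le> trip_end \<alpha> k"] i unfolding k_def by simp
  then have "trip_end \<alpha> i < x" "x \<le> trip_end \<alpha> (Suc i)" using k i by auto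
  then show ?thesis by (rule that)
qed

section \<open>Distance of the server from the origin\<close>

lemma trip_dist_less_le:
  assumes "trip_end \<alpha> k < s" "s \<le> trip_end \<alpha> (Suc k)"
  shows "trip_dist \<alpha> s = min (s - trip_end \<alpha> k) (trip_end \<alpha> (Suc k) - s)"
proof -
  have "(LEAST j. 1 \<le> j \<and> s \<le> trip_end \<alpha> j) = Suc k"
  proof (rule Least_equality)
    fix j assume "1 \<le> j \<and> s \<le> trip_end \<alpha> j"
    with assms have "\<not> trip_end \<alpha> j \<le> trip_end \<alpha> k" by simp
    then show "Suc k \<le> j" by (simp add: trip_end_le_iff)
  qed (use assms in simp)
  then show ?thesis
    by (simp add: trip_dist_def Let_def trip_end_Suc algebra_simps)
qed

lemma trip_dist_0: "trip_dist \<alpha> 0 = 0"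
proof -
  have "(LEAST j. 1 \<le> j \<and> 0 \<le> trip_end \<alpha> j) = 1"
    by (rule Least_equality) (simp_all add: trip_end_nonneg)
  then show ?thesis
    using reach_pos[of 0] by (simp add: trip_dist_def)
qed

lemma trip_dist_trip_end [simp]: "trip_dist \<alpha> (trip_end \<alpha> k) = 0"
proof (cases k)
  case 0
  then show ?thesis by (simp add: trip_dist_0)
next
  case (Suc i)
  then show ?thesis
    using reach_pos[of i] by (subst trip_dist_less_le[of i]) (auto simp: trip_end_Suc)
qed

text \<open>An instant between two trips is assigned by \<open>LEAST\<close> to the trip that it
  ends; the formula of the trip starting there also gives \<open>0\<close>.\<close>

lemma trip_dist_between:
  assumes "trip_end \<alpha> k \<le> s" "s \<le> trip_end \<alpha> (Suc k)"
  shows "trip_dist \<alpha> s = min (s - trip_end \<alpha> k) (trip_end \<alpha> (Suc k) - s)"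
proof (cases "s = trip_end \<alpha> k")
  case True
  with assms show ?thesis by simp
next
  case False
  with assms show ?thesis by (intro trip_dist_less_le) auto
qed

text \<open>In this form the unit speed bound follows from the triangle inequality for
  \<open>infdist\<close>, without a case distinction on the trips that contain the two
  times.\<close>

lemma trip_dist_eq_infdist:
  assumes "0 \<le> s"
  shows "trip_dist \<alpha> s = infdist s (range (trip_end \<alpha>))"
proof (cases "s = 0")
  case True
  have "0 \<in> range (trip_end \<alpha>)" by (rule range_eqI[of _ _ 0]) simp
  with True show ?thesis by (simp add: trip_dist_0)
next
  case False
  with assms obtain k where k: "trip_end \<alpha> k < s" "s \<le> trip_end \<alpha> (Suc k)"
    using trip_of_time[of s] by auto
  have "infdist s (range (trip_end \<alpha>)) = min (s - trip_end \<alpha> k) (trip_end \<alpha> (Suc k) - s)"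
  proof (rule antisym)
    have "infdist s (range (trip_end \<alpha>)) \<le> dist s (trip_end \<alpha> i)" for i
      by (rule infdist_le) simp
    from this[of k] this[of "Suc k"] k
    show "infdist s (range (trip_end \<alpha>)) \<le> min (s - trip_end \<alpha> k) (trip_end \<alpha> (Suc k) - s)"
      by (simp add: dist_real_def)
  next
    have "min (s - trip_end \<alpha> k) (trip_end \<alpha> (Suc k) - s) \<le> dist s (trip_end \<alpha> i)" for i
    proof (cases "i \<le> k")
      case True
      then have "trip_end \<alpha> i \<le> trip_end \<alpha> k" by (simp add: trip_end_le_iff)
      then show ?thesis by (auto simp: dist_real_def)
    next
      case False
      then have "trip_end \<alpha> (Suc k) \<le> trip_end \<alpha> i" by (simp add: trip_end_le_iff)
      then show ?thesis by (auto simp: dist_real_def)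
    qed
    then show "min (s - trip_end \<alpha> k) (trip_end \<alpha> (Suc k) - s) \<le> infdist s (range (trip_end \<alpha>))"
      unfolding infdist_def by (auto intro!: cINF_greatest)
  qed
  with k show ?thesis by (simp add: trip_dist_less_le)
qed

lemma trip_dist_outward:
  assumes "0 \<le> l" "l \<le> reach \<alpha> (Suc k)"
  shows "trip_dist \<alpha> (trip_end \<alpha> k + l) = l"
  using assms by (subst trip_dist_between[of k]) (auto simp: trip_end_Suc)

lemma trip_dist_return:
  assumes "0 \<le> l" "l \<le> reach \<alpha> (Suc k)"
  shows "trip_dist \<alpha> (trip_end \<alpha> (Suc k) - l) = l"
  using assms by (subst trip_dist_between[of k]) (auto simp: trip_end_Suc)

section \<open>Service time of a single request\<close>

lemma ex_reach_ge: "\<exists>j\<ge>n. l \<le> reach \<alpha> j"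
proof -
  \<comment> \<open>The threshold is \<open>l \<le> q ^ i * (1 + 2 * \<alpha>) / 2\<close> solved
    for the power; adding \<open>n\<close> below makes the trip number at least
    \<open>n\<close>.\<close>
  obtain k where k: "2 * l / (1 + 2 * \<alpha>) \<le> trip_end \<alpha> k" using ex_trip_end_ge by blast
  also have "\<dots> \<le> trip_end \<alpha> (Suc (k + n))" by (simp add: trip_end_le_iff)
  finally have "l \<le> reach \<alpha> (Suc (Suc (k + n)))"
    using \<alpha> unfolding trip_end_eq_power reach_Suc_Suc by (simp add: field_simps)
  then show ?thesis by (intro exI[of _ "Suc (Suc (k + n))"]) simp
qed

text \<open>The factor is \<open>2 * q / (q - 1)\<close>, the exact ratio from the second trip on.
  For the first trip the ratio is \<open>2\<close>, which is smaller.\<close>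

lemma trip_end_le_reach:
  "trip_end \<alpha> (Suc k) \<le> (4 + 4 * \<alpha>) / (1 + 2 * \<alpha>) * reach \<alpha> (Suc k)"
proof (cases k)
  case 0
  have "2 * (1 + \<alpha>) \<le> (4 + 4 * \<alpha>) / (1 + 2 * \<alpha>) * (1 + \<alpha>)"
    using \<alpha> by (intro mult_right_mono) (auto simp: field_simps)
  with 0 show ?thesis by (simp add: trip_end_Suc reach_1)
next
  case (Suc i)
  have "(2 + 2 * \<alpha>) * x = (4 + 4 * \<alpha>) / (1 + 2 * \<alpha>) * (x * (1 + 2 * \<alpha>) / 2)" for x
    using \<alpha> by (simp add: divide_simps)
  from this[of "(2 + 2 * \<alpha>) ^ Suc i"] show ?thesis
    unfolding Suc trip_end_eq_power reach_Suc_Suc power_Suc[of _ "Suc i"] by simp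
qed

text \<open>The trip just before the first sufficient one is too short, so it ends by time
  \<open>2 * q / (q - 1) * l\<close>. Travelling outward adds \<open>l\<close>, and
  \<open>2 * q / (q - 1) + 1\<close> is the second ratio of the theorem.\<close>

lemma visit_by_longer_trip:
  assumes "reach \<alpha> (Suc n) < l"
  obtains s where "trip_end \<alpha> (Suc n) \<le> s" "trip_dist \<alpha> s = l"
    "s \<le> (5 + 6 * \<alpha>) / (1 + 2 * \<alpha>) * l"
proof -
  define j where "j = (LEAST j. Suc n \<le> j \<and> l \<le> reach \<alpha> j)"
  have j: "Suc n \<le> j \<and> l \<le> reach \<alpha> j"
    unfolding j_def using ex_reach_ge[of "Suc n" l] by (rule LeastI_ex)
  with assms have "j \<noteq> Suc n" by auto
  with j obtain m where m: "j = Suc (Suc m)" "n \<le> m"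
    by (metis Suc_le_D Suc_le_mono le_SucE)
  then have "\<not> l \<le> reach \<alpha> (Suc m)"
    using not_less_Least[of "Suc m" "\<lambda>j. Suc n \<le> j \<and> l \<le> reach \<alpha> j"] unfolding j_def by auto
  then have less: "reach \<alpha> (Suc m) \<le> l" by simp
  have l: "0 \<le> l" using less reach_pos[of m] by simp
  have "trip_end \<alpha> (Suc m) + l \<le> (4 + 4 * \<alpha>) / (1 + 2 * \<alpha>) * l + l"
    using trip_end_le_reach[of m] mult_left_mono[OF less, of "(4 + 4 * \<alpha>) / (1 + 2 * \<alpha>)"] \<alpha>
    by simp
  also have "\<dots> = (5 + 6 * \<alpha>) / (1 + 2 * \<alpha>) * l"
    using \<alpha> by (simp add: field_simps)
  finally have "trip_end \<alpha> (Suc m) + l \<le> (5 + 6 * \<alpha>) / (1 + 2 * \<alpha>) * l" .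
  moreover have "trip_end \<alpha> (Suc n) \<le> trip_end \<alpha> (Suc m) + l"
    using m l trip_end_le_iff[of "Suc n" "Suc m"] by simp
  moreover have "trip_dist \<alpha> (trip_end \<alpha> (Suc m) + l) = l"
    using l j m by (intro trip_dist_outward) auto
  ultimately show ?thesis by (rule that[rotated -1])
qed

lemma ratio_ge_3: "3 \<le> (5 + 6 * \<alpha>) / (1 + 2 * \<alpha>)"
  using \<alpha> by (simp add: field_simps)

lemma trip_visit_bound:
  assumes "0 \<le> l"
  obtains s where "real t \<le> s" "trip_dist \<alpha> s = l"
    "s \<le> max (2 + 2 * \<alpha>) ((5 + 6 * \<alpha>) / (1 + 2 * \<alpha>)) * max (real t) l"
proof -
  let ?q = "2 + 2 * \<alpha>" and ?b = "(5 + 6 * \<alpha>) / (1 + 2 * \<alpha>)"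
  let ?c = "max ?q ?b" and ?T = "max (real t) l"
  note visit = that
  have mono: "x * y \<le> ?c * ?T" if "0 \<le> x" "x \<le> ?c" "y \<le> ?T" for x y
    using that assms by (intro order_trans[OF mult_left_mono mult_right_mono]) auto
  have long: ?thesis if "reach \<alpha> (Suc n) < l" "real t \<le> trip_end \<alpha> (Suc n)" for n
  proof -
    obtain s where s: "trip_end \<alpha> (Suc n) \<le> s" "trip_dist \<alpha> s = l" "s \<le> ?b * l"
      using visit_by_longer_trip[OF \<open>reach \<alpha> (Suc n) < l\<close>] by blast
    have "?b * l \<le> ?c * ?T" by (rule mono) (use ratio_ge_3 in auto)
    with s \<open>real t \<le> trip_end \<alpha> (Suc n)\<close> show ?thesis by (intro visit[of s]) linarith+
  qed
  show ?thesis
  proof (cases "t = 0")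
    case True
    show ?thesis
    proof (cases "l \<le> reach \<alpha> (Suc 0)")
      case True
      have "1 * l \<le> ?c * ?T" by (rule mono) (use \<alpha> in auto)
      then show ?thesis
        using that[of l] trip_dist_outward[of l 0] True assms \<open>t = 0\<close> by simp
    next
      case False
      then show ?thesis using long[of 0] True trip_end_nonneg by simp
    qed
  next
    case False
    \<comment> \<open>Exactly \<open>i\<close> trips end strictly before the arrival, which
      therefore falls into trip \<open>Suc i\<close>.\<close>
    then obtain i where i: "trip_end \<alpha> i < real t" "real t \<le> trip_end \<alpha> (Suc i)"
      using trip_of_time[of "real t"] by auto
    have end_le: "trip_end \<alpha> (Suc i) \<le> ?q * real t"
    proof (cases i)
      \<comment> \<open>Discrete time matters here: the first trip starts at \<open>0\<close>, so
        its start gives no useful lower bound on \<open>t\<close>, but a nonzero \<open>t\<close> is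
        at least \<open>1\<close>.\<close>
      case 0
      have "?q * 1 \<le> ?q * real t" using \<alpha> False by (intro mult_left_mono) auto
      then show ?thesis using 0 by (simp add: trip_end_eq_power)
    next
      case (Suc i')
      then have "?q * ?q ^ i \<le> ?q * real t"
        using \<alpha> i(1) unfolding Suc trip_end_eq_power by (intro mult_left_mono) auto
      then show ?thesis by (simp add: trip_end_eq_power)
    qed
    consider "reach \<alpha> (Suc i) < l"
      | "l \<le> reach \<alpha> (Suc i)" "real t \<le> trip_end \<alpha> (Suc i) - l"
      | "l \<le> reach \<alpha> (Suc i)" "trip_end \<alpha> (Suc i) - l < real t"
      by linarith
    then show ?thesis
    proof cases
      case 1
      then show ?thesis using long i by blast
    next
      case 2
      have "?q * real t \<le> ?c * ?T" by (rule mono) (use \<alpha> in auto)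
      then show ?thesis
        using that[of "trip_end \<alpha> (Suc i) - l"] trip_dist_return[OF assms 2(1)] 2 end_le assms
        by linarith
    next
      case 3
      have "3 * ?T \<le> ?c * ?T" by (rule mono) (use ratio_ge_3 in auto)
      moreover have "trip_end \<alpha> (Suc i) + l \<le> 3 * ?T" using 3(2) by linarith
      moreover have "l \<le> reach \<alpha> (Suc (Suc i))" using 3(1) reach_Suc_mono by (rule order_trans)
      ultimately show ?thesis
        using that[of "trip_end \<alpha> (Suc i) + l"] trip_dist_outward[OF assms] i assms by fastforce
    qed
  qed
qed

section \<open>From distances to schedules on the half-line\<close>

context
  fixes orig :: real and L :: "real set"
  assumes half_line: "half_line orig L"
begin

text \<open>This makes the \<open>THE\<close> in \<open>trips\<close> well defined.\<close>

lemma half_line_ex1_dist: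
  assumes "0 \<le> d"
  shows "\<exists>!x. x \<in> L \<and> dist orig x = d"
  using half_line unfolding half_line_def
proof
  assume "L = {orig..}"
  then show ?thesis using assms by (intro ex1I[of _ "orig + d"]) (auto simp: dist_real_def)
next
  assume "L = {..orig}"
  then show ?thesis using assms by (intro ex1I[of _ "orig - d"]) (auto simp: dist_real_def)
qed

lemma half_line_orig: "orig \<in> L"
  using half_line by (auto simp: half_line_def)

text \<open>All points lie on the same side of \<open>orig\<close>, so the distance from
  \<open>orig\<close> is an isometric coordinate on \<open>L\<close>, and the Lipschitz bound for
  \<open>trip_dist\<close> carries over to \<open>trips\<close>.\<close>

lemma half_line_dist:
  assumes "x \<in> L" "y \<in> L"
  shows "dist x y = \<bar>dist orig x - dist orig y\<bar>"
  using assms half_line by (auto simp: half_line_def dist_real_def)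

lemma trip_dist_nonneg: "0 \<le> s \<Longrightarrow> 0 \<le> trip_dist \<alpha> s"
  by (simp add: trip_dist_eq_infdist infdist_nonneg)

lemma trips_props:
  assumes "0 \<le> s"
  shows "trips \<alpha> orig L s \<in> L" "dist orig (trips \<alpha> orig L s) = trip_dist \<alpha> s"
  using theI'[OF half_line_ex1_dist[OF trip_dist_nonneg[OF assms]]] by (simp_all add: trips_def)

lemma trips_eqI:
  assumes "0 \<le> s" "x \<in> L" "trip_dist \<alpha> s = dist orig x"
  shows "trips \<alpha> orig L s = x"
  using half_line_ex1_dist[of "dist orig x"] trips_props[OF assms(1)] assms by auto

lemma trips_trip_end [simp]: "trips \<alpha> orig L (trip_end \<alpha> k) = orig"
  by (rule trips_eqI) (simp_all add: trip_end_nonneg half_line_orig)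

lemma trips_lipschitz: "1-lipschitz_on {0..} (trips \<alpha> orig L)"
proof (rule lipschitz_onI)
  fix s s' :: real assume s: "s \<in> {0..}" "s' \<in> {0..}"
  then have "dist (trips \<alpha> orig L s) (trips \<alpha> orig L s') = \<bar>trip_dist \<alpha> s - trip_dist \<alpha> s'\<bar>"
    by (simp add: half_line_dist trips_props)
  also have "\<dots> \<le> dist s s'"
    using s infdist_triangle[of s "range (trip_end \<alpha>)" s']
      infdist_triangle[of s' "range (trip_end \<alpha>)" s]
    by (simp add: trip_dist_eq_infdist dist_commute abs_le_iff)
  finally show "dist (trips \<alpha> orig L s) (trips \<alpha> orig L s') \<le> 1 * dist s s'" by simp
qed simp

lemma trips_schedule: "trips \<alpha> orig L \<in> schedules orig L"
  using trips_trip_end[of 0] trips_props(1) trips_lipschitz by (auto simp: schedules_def)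

text \<open>Since \<open>trips\<close> is at \<open>orig\<close> at every trip end, staying there
  for good amounts to freezing the time argument. In this form the speed bound and the visits are
  inherited from \<open>trips\<close>.\<close>

lemma round_trip_algorithm_cases [case_names endless stopping]:
  obtains "round_trip_algorithm \<alpha> orig L R = trips \<alpha> orig L"
  | k where "\<forall>r \<in># R. completed_by (trips \<alpha> orig L) r (trip_end \<alpha> k)"
      "\<And>s. round_trip_algorithm \<alpha> orig L R s = trips \<alpha> orig L (min s (trip_end \<alpha> k))"
proof -
  define P where "P k \<longleftrightarrow> (\<forall>r \<in># R. completed_by (trips \<alpha> orig L) r (trip_end \<alpha> k))" for k
  have alg: "round_trip_algorithm \<alpha> orig L R s =
      (if \<exists>k. trip_end \<alpha> k \<le> s \<and> P k then orig else trips \<alpha> orig L s)" for s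
    by (simp add: round_trip_algorithm_def P_def)
  show ?thesis
  proof (cases "\<exists>k. P k")
    case False
    then show ?thesis by (intro that(1)) (auto simp: alg)
  next
    case True
    \<comment> \<open>For the least such \<open>k\<close>, the stopping test holds at time
      \<open>s\<close> exactly when \<open>trip_end \<alpha> k \<le> s\<close>.\<close>
    define k where "k = (LEAST k. P k)"
    have k: "P k" unfolding k_def using True by (rule LeastI_ex)
    have "trip_end \<alpha> k \<le> trip_end \<alpha> i" if "P i" for i
      using that by (simp add: trip_end_le_iff k_def Least_le)
    then have "(\<exists>i. trip_end \<alpha> i \<le> s \<and> P i) \<longleftrightarrow> trip_end \<alpha> k \<le> s" for s
      using k by (meson order_trans)
    then have "round_trip_algorithm \<alpha> orig L R s = trips \<alpha> orig L (min s (trip_end \<alpha> k))" for s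
      by (simp add: alg min_def)
    with k show ?thesis by (intro that(2)) (auto simp: P_def)
  qed
qed

lemma round_trip_algorithm_schedule: "round_trip_algorithm \<alpha> orig L R \<in> schedules orig L"
proof (cases R rule: round_trip_algorithm_cases)
  case endless
  then show ?thesis by (simp add: trips_schedule)
next
  case (stopping k)
  then have eq: "round_trip_algorithm \<alpha> orig L R = (\<lambda>s. trips \<alpha> orig L (min s (trip_end \<alpha> k)))"
    by blast
  have "1-lipschitz_on {0..} (round_trip_algorithm \<alpha> orig L R)"
  proof (rule lipschitz_onI)
    fix s s' :: real assume "s \<in> {0..}" "s' \<in> {0..}"
    then have "dist (trips \<alpha> orig L (min s (trip_end \<alpha> k))) (trips \<alpha> orig L (min s' (trip_end \<alpha> k)))
        \<le> 1 * dist (min s (trip_end \<alpha> k)) (min s' (trip_end \<alpha> k))"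
      by (intro lipschitz_onD[OF trips_lipschitz]) (simp_all add: trip_end_nonneg)
    also have "\<dots> \<le> 1 * dist s s'" by (auto simp: dist_real_def min_def)
    finally show "dist (round_trip_algorithm \<alpha> orig L R s) (round_trip_algorithm \<alpha> orig L R s')
        \<le> 1 * dist s s'" by (simp add: eq)
  qed simp
  moreover have "trips \<alpha> orig L 0 = orig" using trips_trip_end[of 0] by simp
  ultimately show ?thesis
    using trips_props(1) trip_end_nonneg[of k] by (auto simp: schedules_def eq min_def)
qed

text \<open>Stopping loses no completion, because the server stops only when all requests of
  \<open>R\<close> have been completed.\<close>

lemma completed_by_round_trip_algorithm:
  assumes "r \<in># R" "completed_by (trips \<alpha> orig L) r T"
  shows "completed_by (round_trip_algorithm \<alpha> orig L R) r T"
proof (cases R rule: round_trip_algorithm_cases)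
  case endless
  with assms show ?thesis by simp
next
  case (stopping k)
  show ?thesis
  proof (cases "T \<le> trip_end \<alpha> k")
    case True
    with assms(2) stopping(2) show ?thesis by (auto simp: completed_by_def visits_def)
  next
    case False
    \<comment> \<open>The visit assumed in \<open>assms(2)\<close> may come after the stop, so a
      visit before the stop replaces it.\<close>
    from stopping(1) assms(1) have "completed_by (trips \<alpha> orig L) r (trip_end \<alpha> k)" by simp
    then obtain s where "s \<in> visits (trips \<alpha> orig L) r" "s \<le> trip_end \<alpha> k"
      by (auto simp: completed_by_def)
    with False stopping(2) show ?thesis
      by (auto simp: completed_by_def visits_def intro!: exI[of _ s])
  qed
qed

text \<open>Had the stopping test succeeded by time \<open>s\<close>, every request would be
  completed by then. Hence two runs that both have open requests are at the same position, as the
  online property demands.\<close>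

lemma round_trip_algorithm_eq_trips:
  assumes "\<exists>r \<in># R. \<not> completed_by (round_trip_algorithm \<alpha> orig L R) r s"
  shows "round_trip_algorithm \<alpha> orig L R s = trips \<alpha> orig L s"
proof -
  have "\<not> (trip_end \<alpha> k \<le> s \<and> (\<forall>r \<in># R. completed_by (trips \<alpha> orig L) r (trip_end \<alpha> k)))" for k
    using assms completed_by_round_trip_algorithm[of _ R "trip_end \<alpha> k"]
    by (meson completed_by_def order_trans)
  then show ?thesis by (auto simp: round_trip_algorithm_def)
qed

lemma round_trip_algorithm_online: "online_algorithm orig L (round_trip_algorithm \<alpha> orig L)"
  by (auto simp: online_algorithm_def round_trip_algorithm_schedule round_trip_algorithm_eq_trips)

lemma completion_time_round_trip_algorithm:
  assumes "r \<in># R" "location r \<in> L"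
  shows "completion_time (round_trip_algorithm \<alpha> orig L R) r
    \<le> ereal (max (2 + 2 * \<alpha>) ((5 + 6 * \<alpha>) / (1 + 2 * \<alpha>))
        * max (real (arrival r)) (dist orig (location r)))"
proof -
  obtain s where s: "real (arrival r) \<le> s" "trip_dist \<alpha> s = dist orig (location r)"
    "s \<le> max (2 + 2 * \<alpha>) ((5 + 6 * \<alpha>) / (1 + 2 * \<alpha>))
        * max (real (arrival r)) (dist orig (location r))"
    using trip_visit_bound[of "dist orig (location r)" "arrival r"] by auto
  have "0 \<le> s" using s(1) by (rule order_trans[rotated]) simp
  then have "completed_by (trips \<alpha> orig L) r s"
    using s assms(2) trips_eqI by (auto simp: completed_by_def visits_def)
  with assms(1) have "completed_by (round_trip_algorithm \<alpha> orig L R) r s"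
    by (rule completed_by_round_trip_algorithm)
  then have "completion_time (round_trip_algorithm \<alpha> orig L R) r \<le> ereal s"
    unfolding completed_by_def completion_time_def by (auto intro: INF_lower2)
  also note ereal_less_eq(3)[THEN iffD2, OF s(3)]
  finally show ?thesis .
qed

end

end

section \<open>Lower bound for the optimum and comparison of costs\<close>

lemma completion_time_ge:
  assumes "p \<in> schedules orig L"
  shows "ereal (max (real (arrival r)) (dist orig (location r))) \<le> completion_time p r"
  unfolding completion_time_def
\<comment> \<open>Only actual visits need a bound; for a request never visited the infimum is
  infinite.\<close>
proof (rule INF_greatest)
  fix s assume "s \<in> visits p r"
  then have s: "real (arrival r) \<le> s" "p s = location r" by (auto simp: visits_def)
  have "0 \<le> s" using s(1) by (rule order_trans[rotated]) simp
  then have "dist (p 0) (p s) \<le> 1 * dist 0 s"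
    using assms by (intro lipschitz_onD[of _ "{0..}"]) (auto simp: schedules_def)
  with s assms \<open>0 \<le> s\<close> show "ereal (max (real (arrival r)) (dist orig (location r))) \<le> ereal s"
    by (simp add: schedules_def)
qed

text \<open>Moves the sum into the reals, where a factor can be pulled out without side conditions
  on infinite values.\<close>

lemma sum_mset_ereal: "(\<Sum>x\<in>#M. ereal (f x)) = ereal (\<Sum>x\<in>#M. f x)"
  by (induction M) simp_all

theorem theorem2:
  fixes \<alpha> orig :: real and L :: "real set"
  assumes "\<alpha> > 0" and "half_line orig L"
  shows "online_algorithm orig L (round_trip_algorithm \<alpha> orig L) \<and>
         competitive orig L (max (2 + 2 * \<alpha>) ((5 + 6 * \<alpha>) / (1 + 2 * \<alpha>)))
           (round_trip_algorithm \<alpha> orig L)"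
proof
  show "online_algorithm orig L (round_trip_algorithm \<alpha> orig L)"
    using assms by (rule round_trip_algorithm_online)
next
  define c where "c = max (2 + 2 * \<alpha>) ((5 + 6 * \<alpha>) / (1 + 2 * \<alpha>))"
  \<comment> \<open>\<open>m r\<close> links the two costs: each schedule needs at least
    \<open>m r\<close> for \<open>r\<close>, and the algorithm at most
    \<open>c * m r\<close>.\<close>
  define m where "m r = max (real (arrival r)) (dist orig (location r))" for r
  have c: "0 \<le> c" using assms(1) by (simp add: c_def)
  have "cost (round_trip_algorithm \<alpha> orig L R) R \<le> ereal c * OPT orig L R"
    if R: "R \<in> inputs L" for R
  proof -
    have "cost (round_trip_algorithm \<alpha> orig L R) R \<le> (\<Sum>r\<in>#R. ereal (c * m r))"
      unfolding cost_def c_def m_def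
      using R by (intro sum_mset_mono completion_time_round_trip_algorithm assms)
        (auto simp: inputs_def)
    also have "\<dots> = ereal c * (\<Sum>r\<in>#R. ereal (m r))"
      by (simp add: sum_mset_ereal sum_mset_distrib_left)
    also have "\<dots> \<le> ereal c * OPT orig L R"
    proof (rule ereal_mult_left_mono)
      show "(\<Sum>r\<in>#R. ereal (m r)) \<le> OPT orig L R"
        unfolding OPT_def cost_def m_def
        by (intro INF_greatest sum_mset_mono completion_time_ge)
    qed (use c in simp)
    finally show ?thesis .
  qed
  then show "competitive orig L (max (2 + 2 * \<alpha>) ((5 + 6 * \<alpha>) / (1 + 2 * \<alpha>)))
      (round_trip_algorithm \<alpha> orig L)"
    by (auto simp: competitive_def c_def)
qed

end
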